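(* Let $X$ be a separable metric space and let $S\subset C_s(\mathbb{R},X)$ be a shift-invariant set that satisfies the compactness axiom. Then there exists a one-to-one correspondence (bijection) between the set $$\{S'\subset S \mid S' \text{ is shift-invariant, maximal with respect to phase space, and } \pi(S') \text{ is compact}\}$$ and the set $$\{A\subset X \mid A \text{ is weakly invariant and compact}\}.$$
   Context: A partial map with open domain $\phi:\mathbb{R}\to X$ is a continuous map $\phi:\mathrm{dom}\,\phi\to X$ defined on an open set $\mathrm{dom}\,\phi\subset\mathbb{R}$; write $\mathrm{im}\,\phi=\phi(\mathrm{dom}\,\phi)$. The set $C_p(\mathbb{R},X)$ of all of these carries the compact-open topology with subbasis $W(K,V)=\{\phi : K\subset\mathrm{dom}\,\phi,\ \phi(K)\subset V\}$, $K\subset\mathbb{R}$ compact, $V\subset X$ open; equivalently, $\phi_n\to\phi$ iff for each compact $K\subset\mathrm{dom}\,\phi$ one has $K\subset\mathrm{dom}\,\phi_n$ for all large $n$ and $\sup_{t\in K}d(\phi_n(t),\phi(t))\to0$. A $\phi\in C_p(\mathbb{R},X)$ with nonempty connected domain is maximally defined if any $\psi\in C_p(\mathbb{R},X)$ with nonempty connected domain, $\mathrm{dom}\,\phi\subset\mathrm{dom}\,\psi$ and $\psi=\phi$ on $\mathrm{dom}\,\phi$ equals $\phi$. $C_s(\mathbb{R},X)$ is the subspace of maximally defined maps. Shift: $\sigma(t,\phi)(s)=\phi(s+t)$ for $s\in\mathrm{dom}\,\phi-t$. A set $S\subset C_s(\mathbb{R},X)$ is shift-invariant if $\sigma(t,\phi)\in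 S$ for all $\phi\in S$, $t\in\mathbb{R}$. Compactness axiom for $S$: for every compact $W\subset\mathbb{R}\times X$, the set $\{(t,\phi)\in\mathbb{R}\times S : t\in\mathrm{dom}\,\phi,\ (t,\phi(t))\in W\}$ is compact. $\pi$ is the partial map $C_s(\mathbb{R},X)\to X$, $\pi(\phi)=\phi(0)$, defined when $0\in\mathrm{dom}\,\phi$; $\pi(S')=\{\phi(0) : \phi\in S',\ 0\in\mathrm{dom}\,\phi\}$. $A\subset X$ is weakly invariant (with respect to $S$) if for every $x\in A$ there is $\phi\in S$ with $\phi(0)=x$ and $\mathrm{im}\,\phi\subset A$. A shift-invariant subset $S'\subset S$ is maximal with respect to phase space if for every shift-invariant $S''\subset S$, $\pi(S')=\pi(S'')$ implies $S''\subset S'$. *)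

theory Defs
  imports "HOL-Analysis.Analysis"
begin

text \<open>
  A partial map from the reals to \<open>X\<close> is a term of type \<^typ>\<open>real \<rightharpoonup> 'a\<close>; its domain is
  \<^const>\<open>dom\<close>, its image is \<^const>\<open>ran\<close>, and equality of partial maps (same domain, same values)
  is equality of terms. The map with empty domain belongs to \<open>Cp\<close> but not to \<open>Cs\<close>.
\<close>

definition Cp :: "(real \<rightharpoonup> 'a::topological_space) set" where
  "Cp = {\<phi>. open (dom \<phi>) \<and> continuous_on (dom \<phi>) (\<lambda>t. the (\<phi> t))}"

definition co_subbasic :: "real set \<Rightarrow> 'a::topological_space set \<Rightarrow> (real \<rightharpoonup> 'a) set" where
  "co_subbasic K V = {\<phi> \<in> Cp. K \<subseteq> dom \<phi> \<and> (\<lambda>t. the (\<phi> t)) ` K \<subseteq> V}"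

definition Cp_topology :: "(real \<rightharpoonup> 'a::topological_space) topology" where
  "Cp_topology = topology_generated_by {co_subbasic K V | K V. compact K \<and> open V}"

lemma topspace_Cp_topology: "topspace Cp_topology = Cp"
proof -
  have "Cp = co_subbasic {} UNIV"
    by (auto simp: co_subbasic_def)
  then have "Cp \<in> {co_subbasic K V | K V. compact K \<and> open V}"
    using compact_empty open_UNIV by blast
  moreover have "co_subbasic K V \<subseteq> Cp" for K V
    by (auto simp: co_subbasic_def)
  ultimately show ?thesis
    unfolding Cp_topology_def topology_generated_by_topspace by blast
qed

definition maximally_defined :: "(real \<rightharpoonup> 'a::topological_space) \<Rightarrow> bool" where
  "maximally_defined \<phi> \<longleftrightarrow>
     \<phi> \<in> Cp \<and> dom \<phi> \<noteq> {} \<and> connected (dom \<phi>) \<and>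
     (\<forall>\<psi>\<in>Cp. dom \<psi> \<noteq> {} \<longrightarrow> connected (dom \<psi>) \<longrightarrow> dom \<phi> \<subseteq> dom \<psi> \<longrightarrow>
        (\<forall>t\<in>dom \<phi>. \<psi> t = \<phi> t) \<longrightarrow> \<psi> = \<phi>)"

definition Cs :: "(real \<rightharpoonup> 'a::topological_space) set" where
  "Cs = {\<phi>. maximally_defined \<phi>}"

definition Cs_topology :: "(real \<rightharpoonup> 'a::topological_space) topology" where
  "Cs_topology = subtopology Cp_topology Cs"

definition shift :: "real \<Rightarrow> (real \<rightharpoonup> 'a) \<Rightarrow> (real \<rightharpoonup> 'a)" where
  "shift t \<phi> = (\<lambda>s. \<phi> (s + t))"

lemma dom_shift: "dom (shift t \<phi>) = (\<lambda>s. s - t) ` dom \<phi>"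
proof (intro set_eqI iffI)
  fix s assume "s \<in> dom (shift t \<phi>)"
  then have "s + t \<in> dom \<phi>" "s = (s + t) - t"
    by (auto simp: shift_def dom_def)
  then show "s \<in> (\<lambda>s. s - t) ` dom \<phi>"
    by blast
qed (auto simp: shift_def dom_def)

definition shift_invariant :: "(real \<rightharpoonup> 'a) set \<Rightarrow> bool" where
  "shift_invariant S \<longleftrightarrow> (\<forall>\<phi>\<in>S. \<forall>t. shift t \<phi> \<in> S)"

definition compactness_axiom :: "(real \<rightharpoonup> 'a::topological_space) set \<Rightarrow> bool" where
  "compactness_axiom S \<longleftrightarrow>
     (\<forall>W :: (real \<times> 'a) set. compact W \<longrightarrow>
        compactin (prod_topology euclideanreal Cs_topology)
          {(t, \<phi>). \<phi> \<in> S \<and> t \<in> dom \<phi> \<and> (t, the (\<phi> t)) \<in> W})"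

definition phase_proj :: "(real \<rightharpoonup> 'a) \<rightharpoonup> 'a" where
  "phase_proj \<phi> = \<phi> 0"

definition phase_image :: "(real \<rightharpoonup> 'a) set \<Rightarrow> 'a set" where
  "phase_image S = {x. \<exists>\<phi>\<in>S. phase_proj \<phi> = Some x}"

definition weakly_invariant :: "(real \<rightharpoonup> 'a) set \<Rightarrow> 'a set \<Rightarrow> bool" where
  "weakly_invariant S A \<longleftrightarrow> (\<forall>x\<in>A. \<exists>\<phi>\<in>S. \<phi> 0 = Some x \<and> ran \<phi> \<subseteq> A)"

definition maximal_wrt_phase_space :: "(real \<rightharpoonup> 'a) set \<Rightarrow> (real \<rightharpoonup> 'a) set \<Rightarrow> bool" where
  "maximal_wrt_phase_space S S' \<longleftrightarrow>
     (\<forall>S''. S'' \<subseteq> S \<longrightarrow> shift_invariant S'' \<longrightarrow> phase_image S' = phase_image S'' \<longrightarrow> S'' \<subseteq> S')"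

end

theory Submission
  imports Defs
begin

text \<open>
  The correspondence is \<open>S' \<mapsto> \<pi>(S')\<close>, with inverse \<open>A \<mapsto> S\<^sub>A = {\<phi> \<in> S. im \<phi> \<subseteq> A}\<close>.

  Shift-invariance lets every value of a trajectory be moved to time \<open>0\<close>, so \<open>\<pi>(S')\<close> is the union
  of the full images of the maps in \<open>S'\<close> (\<open>phase_image_eq_Union_ran\<close>). Two consequences carry the
  proof. First, \<open>\<pi>(S')\<close> is always weakly invariant: the map that witnesses \<open>x \<in> \<pi>(S')\<close> never leaves
  \<open>\<pi>(S')\<close>. Second, a shift-invariant set with phase image \<open>A\<close> consists of maps with values in \<open>A\<close>, so
  it is contained in \<open>S\<^sub>A\<close>. Weak invariance of \<open>A\<close> says exactly that \<open>S\<^sub>A\<close> has phase image all of \<open>A\<close>,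
  hence \<open>S\<^sub>A\<close> is the largest shift-invariant set over \<open>A\<close>. Maximality with respect to phase space
  singles out this one set in each fibre of \<open>\<pi>\<close>. Compactness is imposed on both sides as the same
  condition on \<open>A = \<pi>(S')\<close>, so the correspondence respects it.
\<close>

definition trajectories_within :: "(real \<rightharpoonup> 'a) set \<Rightarrow> 'a set \<Rightarrow> (real \<rightharpoonup> 'a) set" where
  "trajectories_within S A = {\<phi> \<in> S. ran \<phi> \<subseteq> A}"

lemma ran_shift: "ran (shift t \<phi>) = ran \<phi>"
proof
  show "ran (shift t \<phi>) \<subseteq> ran \<phi>"
    by (auto simp: shift_def ran_def)
  show "ran \<phi> \<subseteq> ran (shift t \<phi>)"
  proof
    fix x assume "x \<in> ran \<phi>"
    then obtain s where "\<phi> s = Some x"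
      by (auto simp: ran_def)
    then have "shift t \<phi> (s - t) = Some x"
      by (simp add: shift_def)
    then show "x \<in> ran (shift t \<phi>)"
      by (rule ranI)
  qed
qed

text \<open>
  The value \<open>\<phi>(t)\<close> is the value at time \<open>0\<close> of the shifted map \<open>\<sigma>(t, \<phi>)\<close>, which stays in the set.
\<close>

lemma phase_image_eq_Union_ran:
  assumes "shift_invariant S"
  shows "phase_image S = (\<Union>\<phi>\<in>S. ran \<phi>)"
proof
  show "phase_image S \<subseteq> (\<Union>\<phi>\<in>S. ran \<phi>)"
    by (auto simp: phase_image_def phase_proj_def intro: ranI)
  show "(\<Union>\<phi>\<in>S. ran \<phi>) \<subseteq> phase_image S"
  proof
    fix x assume "x \<in> (\<Union>\<phi>\<in>S. ran \<phi>)"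
    then obtain \<phi> t where "\<phi> \<in> S" "\<phi> t = Some x"
      by (auto simp: ran_def)
    then have "shift t \<phi> \<in> S" "phase_proj (shift t \<phi>) = Some x"
      using assms by (auto simp: shift_invariant_def phase_proj_def shift_def)
    then show "x \<in> phase_image S"
      by (auto simp: phase_image_def)
  qed
qed

lemma weakly_invariant_phase_image:
  assumes "S' \<subseteq> S" and "shift_invariant S'"
  shows "weakly_invariant S (phase_image S')"
  unfolding weakly_invariant_def
proof
  fix x assume "x \<in> phase_image S'"
  then obtain \<phi> where "\<phi> \<in> S'" "\<phi> 0 = Some x"
    by (auto simp: phase_image_def phase_proj_def)
  moreover from \<open>\<phi> \<in> S'\<close> have "ran \<phi> \<subseteq> phase_image S'"
    by (auto simp: phase_image_eq_Union_ran[OF assms(2)])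
  ultimately show "\<exists>\<phi>\<in>S. \<phi> 0 = Some x \<and> ran \<phi> \<subseteq> phase_image S'"
    using assms(1) by blast
qed

lemma shift_invariant_trajectories_within:
  "shift_invariant S \<Longrightarrow> shift_invariant (trajectories_within S A)"
  by (simp add: shift_invariant_def trajectories_within_def ran_shift)

lemma phase_image_trajectories_within:
  assumes "weakly_invariant S A"
  shows "phase_image (trajectories_within S A) = A"
  using assms
  by (fastforce simp: phase_image_def phase_proj_def trajectories_within_def
      weakly_invariant_def intro: ranI)

lemma subset_trajectories_within_phase_image:
  assumes "S' \<subseteq> S" and "shift_invariant S'"
  shows "S' \<subseteq> trajectories_within S (phase_image S')"
  using assms(1) by (auto simp: trajectories_within_def phase_image_eq_Union_ran[OF assms(2)])

lemma maximal_trajectories_within: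
  assumes "weakly_invariant S A"
  shows "maximal_wrt_phase_space S (trajectories_within S A)"
  unfolding maximal_wrt_phase_space_def phase_image_trajectories_within[OF assms]
  using subset_trajectories_within_phase_image by blast

theorem theoremA:
  fixes S :: "(real \<rightharpoonup> 'a::metric_space) set"
  assumes "separable_space (euclidean :: 'a topology)"
    and "S \<subseteq> Cs"
    and "shift_invariant S"
    and "compactness_axiom S"
  shows "\<exists>f. bij_betw f
           {S'. S' \<subseteq> S \<and> shift_invariant S' \<and> maximal_wrt_phase_space S S' \<and>
                compact (phase_image S')}
           {A :: 'a set. weakly_invariant S A \<and> compact A}"
    (is "\<exists>f. bij_betw f ?M ?W")
proof
  show "bij_betw phase_image ?M ?W"
    unfolding bij_betw_def
  proof
    \<comment> \<open>Two maximal sets with the same phase image contain each other.\<close>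
    show "inj_on phase_image ?M"
    proof (rule inj_onI)
      fix S\<^sub>1 S\<^sub>2 assume "S\<^sub>1 \<in> ?M" "S\<^sub>2 \<in> ?M" "phase_image S\<^sub>1 = phase_image S\<^sub>2"
      then show "S\<^sub>1 = S\<^sub>2"
        by (simp add: maximal_wrt_phase_space_def subset_antisym)
    qed
    show "phase_image ` ?M = ?W"
    proof
      show "phase_image ` ?M \<subseteq> ?W"
        using weakly_invariant_phase_image by blast
      show "?W \<subseteq> phase_image ` ?M"
      proof
        fix A assume "A \<in> ?W"
        then have "weakly_invariant S A" "compact A"
          by auto
        then have "trajectories_within S A \<in> ?M"
          using shift_invariant_trajectories_within[OF assms(3)] maximal_trajectories_within
          by (auto simp: phase_image_trajectories_within) (auto simp: trajectories_within_def)
        then show "A \<in> phase_image ` ?M"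
          using phase_image_trajectories_within[OF \<open>weakly_invariant S A\<close>] by blast
      qed
    qed
  qed
qed

end
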